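(* There exists $f\in\mathscr{F}$ such that $\mathscr{P}_f\cap\mathscr{T}_f\neq\emptyset$ and $\mathscr{P}_f\setminus\mathscr{T}_f\neq\emptyset$.
   Context: For a transcendental entire function $f:\mathbb{C}\to\mathbb{C}$, $J(f)$ is its Julia set, $\mathrm{Sing}(f^{-1})$ is the set of finite singularities of $f^{-1}$ (critical values and asymptotic values of $f$ together with their finite limit points), and $\rho_f=\limsup_{z\to\infty}\frac{\log\log|f(z)|}{\log|z|}$ is the order of $f$. The class $\mathscr{F}$ consists of all transcendental entire functions $f$ such that: (1) $f$ has finite order; (2) (rapid derivative growth) there are $\alpha_2>0$, $\alpha_1>-\alpha_2$ and $\kappa>0$ such that $|f'(z)|\ge\kappa^{-1}|z|^{\alpha_1}|f(z)|^{\alpha_2}$ for every $z\in J(f)$; (3) (disjoint type) $\mathrm{Sing}(f^{-1})$ is contained in a compact subset of the immediate basin $B=B(z_0)$ of an attracting fixed point $z_0\in\mathbb{C}$. Fundamental domains. Given $f\in\mathscr{F}$, fix a bounded simply connected domain $D$ whose boundary is an analytic Jordan curve, with $\overline{D}\subset B$, $\overline{\mathrm{Sing}(f^{-1})}\subset D$ and $\overline{f(D)}\subset D$. The connected components of $f^{-1}(\mathbb{C}\setminus\overline{D})$ are the tracts of $f$. Fix an open simple arc $\alpha:(0,\infty)\to\mathbb{C}\setminus\overline{D}$, disjoint from the union of the closures of all tracts, with $\alpha(t)$ tending to a point of $\partial D$ as $t\to0^+$ and $\alpha(t)\to\infty$ as $t\to+\infty$. For each tract $T$, the connected components of $T\setminus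 f^{-1}(\alpha)$ are called fundamental domains; $\mathcal{S}$ is the collection of all fundamental domains of all tracts. One has $J(f)\subset\bigcup_{S\in\mathcal{S}}S$. Potentials. Fix constants $\alpha_1,\alpha_2$ as in (2) and $\tau\in(0,\alpha_2)$ with $\alpha_1+\tau>0$. Let $|f'(z)|_\theta=|f'(z)|\,\frac{|z|^\tau}{|f(z)|^\tau}$ be the derivative of $f$ with respect to the metric $d\theta(z)=|z|^{-\tau}|dz|$ on $\mathbb{C}\setminus\{0\}$. Let $\mathscr{C}$ be the set of functions $\psi:\bigcup_{S\in\mathcal{S}}S\to\mathbb{R}^+=(0,\infty)$ that are bounded from above and constant on each $S\in\mathcal{S}$. Define (as functions on $J(f)$) $$\mathscr{P}_f=\Big\{\varphi_{\psi,t}=\log\psi-t\log|f'|_\theta:\ \psi\in\mathscr{C},\ t>\tfrac{\rho_f}{\alpha_1+\tau}\Big\},$$ $$\mathscr{T}_f=\Big\{\varphi=h-t\log|f'|_\theta:\ h:J(f)\to\mathbb{R}\text{ is a bounded weakly H\"older function},\ t>\tfrac{\rho_f}{\alpha_1+\alpha_2}\Big\}$$ (the class of tame potentials). Here $h:J(f)\to\mathbb{R}$ is weakly H\"older if there are $\delta>0$, $C>0$, $r\in(0,1)$ such that for all $n\ge0$ and $z\in J(f)$ one has $|h(w)-h(w')|\le Cr^n$ whenever $w,w'\in J(f)$ are such that for every $j=0,\dots,n$ each of $f^j(w),f^j(w')$ lies at distance less than $\delta$ from $f^j(z)$ and in the same fundamental domain as $f^j(z)$. *)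

theory Defs
  imports "HOL-Complex_Analysis.Complex_Analysis" "HOL-Library.FuncSet"
begin

definition transcendental_entire :: "(complex \<Rightarrow> complex) \<Rightarrow> bool" where
  "transcendental_entire f \<longleftrightarrow> f holomorphic_on UNIV \<and> \<not> (\<exists>p. \<forall>z. f z = poly p z)"

text \<open>The upper limit is taken in the extended reals. \<open>log log\<close> is read as
  \<open>-\<infinity>\<close> at points where \<open>|f z| \<le> 1\<close>, where the real-valued iterated
  logarithm is not meaningful; such points never influence the order of a
  transcendental function.\<close>

definition entire_order :: "(complex \<Rightarrow> complex) \<Rightarrow> ereal" where
  "entire_order f = Limsup at_infinity
     (\<lambda>z. if norm (f z) > 1 then ereal (ln (ln (norm (f z))) / ln (norm z)) else - \<infinity>)"

text \<open>Normality on a domain \<open>U\<close> with respect to the spherical metric: every sequence of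
  members of the family has a subsequence that converges locally uniformly on \<open>U\<close>,
  either to a finite function or to \<open>\<infinity>\<close>.\<close>

definition normal_family_on :: "complex set \<Rightarrow> (complex \<Rightarrow> complex) set \<Rightarrow> bool" where
  "normal_family_on U \<F> \<longleftrightarrow>
     (\<forall>F :: nat \<Rightarrow> complex \<Rightarrow> complex. range F \<subseteq> \<F> \<longrightarrow>
        (\<exists>r :: nat \<Rightarrow> nat. strict_mono r \<and>
           ((\<exists>g. \<forall>K. compact K \<and> K \<subseteq> U \<longrightarrow> uniform_limit K (\<lambda>k. F (r k)) g sequentially) \<or>
            (\<forall>K. compact K \<and> K \<subseteq> U \<longrightarrow>
               (\<forall>M::real. \<forall>\<^sub>F k in sequentially. \<forall>z\<in>K. norm (F (r k) z) > M)))))"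

definition fatou_set :: "(complex \<Rightarrow> complex) \<Rightarrow> complex set" where
  "fatou_set f =
     {z. \<exists>U. open U \<and> connected U \<and> z \<in> U \<and> normal_family_on U (range (\<lambda>n. f ^^ n))}"

definition julia_set :: "(complex \<Rightarrow> complex) \<Rightarrow> complex set" where
  "julia_set f = - fatou_set f"

definition critical_values :: "(complex \<Rightarrow> complex) \<Rightarrow> complex set" where
  "critical_values f = f ` {z. deriv f z = 0}"

definition asymptotic_values :: "(complex \<Rightarrow> complex) \<Rightarrow> complex set" where
  "asymptotic_values f =
     {a. \<exists>\<gamma> :: real \<Rightarrow> complex. continuous_on {0..} \<gamma> \<and>
           filterlim \<gamma> at_infinity at_top \<and> ((\<lambda>t. f (\<gamma> t)) \<longlongrightarrow> a) at_top}"

definition sing_inv :: "(complex \<Rightarrow> complex) \<Rightarrow> complex set" where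
  "sing_inv f = closure (critical_values f \<union> asymptotic_values f)"

definition attracting_fixed_point :: "(complex \<Rightarrow> complex) \<Rightarrow> complex \<Rightarrow> bool" where
  "attracting_fixed_point f z0 \<longleftrightarrow> f z0 = z0 \<and> norm (deriv f z0) < 1"

definition immediate_basin :: "(complex \<Rightarrow> complex) \<Rightarrow> complex \<Rightarrow> complex set" where
  "immediate_basin f z0 = connected_component_set {z. (\<lambda>n. (f ^^ n) z) \<longlonglongrightarrow> z0} z0"

definition disjoint_type_at :: "(complex \<Rightarrow> complex) \<Rightarrow> complex \<Rightarrow> bool" where
  "disjoint_type_at f z0 \<longleftrightarrow> attracting_fixed_point f z0 \<and>
     (\<exists>K. compact K \<and> K \<subseteq> immediate_basin f z0 \<and> sing_inv f \<subseteq> K)"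

text \<open>The powers below have their usual meaning at every \<open>z \<noteq> 0\<close>; only at \<open>z = 0\<close>
  with \<open>\<alpha>\<^sub>1 \<le> 0\<close> does \<open>powr\<close> take a conventional value.\<close>

definition rapid_derivative_growth :: "(complex \<Rightarrow> complex) \<Rightarrow> real \<Rightarrow> real \<Rightarrow> bool" where
  "rapid_derivative_growth f \<alpha>\<^sub>1 \<alpha>\<^sub>2 \<longleftrightarrow> \<alpha>\<^sub>2 > 0 \<and> \<alpha>\<^sub>1 > - \<alpha>\<^sub>2 \<and>
     (\<exists>\<kappa>>0. \<forall>z\<in>julia_set f.
        norm (deriv f z) \<ge> inverse \<kappa> * norm z powr \<alpha>\<^sub>1 * norm (f z) powr \<alpha>\<^sub>2)"

definition class_F :: "(complex \<Rightarrow> complex) set" where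
  "class_F = {f. transcendental_entire f \<and> entire_order f < \<infinity> \<and>
                 (\<exists>\<alpha>\<^sub>1 \<alpha>\<^sub>2. rapid_derivative_growth f \<alpha>\<^sub>1 \<alpha>\<^sub>2) \<and>
                 (\<exists>z0. disjoint_type_at f z0)}"

text \<open>An analytic Jordan curve is the image of the unit circle under a map that is
  conformal in a neighbourhood of the circle.\<close>

definition analytic_jordan_curve :: "complex set \<Rightarrow> bool" where
  "analytic_jordan_curve \<Gamma> \<longleftrightarrow>
     (\<exists>A g. open A \<and> sphere 0 1 \<subseteq> A \<and> g holomorphic_on A \<and> inj_on g A \<and> \<Gamma> = g ` sphere 0 1)"

definition base_domain :: "(complex \<Rightarrow> complex) \<Rightarrow> complex \<Rightarrow> complex set \<Rightarrow> bool" where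
  "base_domain f z0 D \<longleftrightarrow>
     bounded D \<and> open D \<and> connected D \<and> simply_connected D \<and> analytic_jordan_curve (frontier D) \<and>
     closure D \<subseteq> immediate_basin f z0 \<and> closure (sing_inv f) \<subseteq> D \<and> closure (f ` D) \<subseteq> D"

definition tracts :: "(complex \<Rightarrow> complex) \<Rightarrow> complex set \<Rightarrow> complex set set" where
  "tracts f D = components (f -` (- closure D))"

definition cutting_arc :: "(complex \<Rightarrow> complex) \<Rightarrow> complex set \<Rightarrow> (real \<Rightarrow> complex) \<Rightarrow> bool" where
  "cutting_arc f D \<alpha> \<longleftrightarrow>
     continuous_on {0<..} \<alpha> \<and> inj_on \<alpha> {0<..} \<and> \<alpha> ` {0<..} \<subseteq> - closure D \<and>
     \<alpha> ` {0<..} \<inter> (\<Union>T\<in>tracts f D. closure T) = {} \<and>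
     (\<exists>p\<in>frontier D. (\<alpha> \<longlongrightarrow> p) (at_right 0)) \<and> filterlim \<alpha> at_infinity at_top"

definition fundamental_domains ::
    "(complex \<Rightarrow> complex) \<Rightarrow> complex set \<Rightarrow> (real \<Rightarrow> complex) \<Rightarrow> complex set set" where
  "fundamental_domains f D \<alpha> = (\<Union>T\<in>tracts f D. components (T - f -` (\<alpha> ` {0<..})))"

definition deriv_theta :: "(complex \<Rightarrow> complex) \<Rightarrow> real \<Rightarrow> complex \<Rightarrow> real" where
  "deriv_theta f \<tau> z = norm (deriv f z) * (norm z powr \<tau> / norm (f z) powr \<tau>)"

definition locally_constant_weights :: "complex set set \<Rightarrow> (complex \<Rightarrow> real) set" where
  "locally_constant_weights \<S> =
     {\<psi>. (\<forall>z\<in>\<Union>\<S>. \<psi> z > 0) \<and> (\<exists>M. \<forall>z\<in>\<Union>\<S>. \<psi> z \<le> M) \<and> (\<forall>S\<in>\<S>. \<psi> constant_on S)}"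

definition weakly_hoelder ::
    "(complex \<Rightarrow> complex) \<Rightarrow> complex set set \<Rightarrow> (complex \<Rightarrow> real) \<Rightarrow> bool" where
  "weakly_hoelder f \<S> h \<longleftrightarrow>
     (\<exists>\<delta>>0. \<exists>C>0. \<exists>r. 0 < r \<and> r < 1 \<and>
        (\<forall>n. \<forall>z\<in>julia_set f. \<forall>w\<in>julia_set f. \<forall>w'\<in>julia_set f.
           (\<forall>j\<le>n. dist ((f ^^ j) w) ((f ^^ j) z) < \<delta> \<and> dist ((f ^^ j) w') ((f ^^ j) z) < \<delta> \<and>
              (\<exists>S\<in>\<S>. (f ^^ j) z \<in> S \<and> (f ^^ j) w \<in> S \<and> (f ^^ j) w' \<in> S))
           \<longrightarrow> \<bar>h w - h w'\<bar> \<le> C * r ^ n))"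

text \<open>Potentials are functions on the Julia set only, so they are represented by
  functions restricted to it (\<open>undefined\<close> elsewhere); equality of two potentials is then
  equality on the Julia set.\<close>

definition potentials_P ::
    "(complex \<Rightarrow> complex) \<Rightarrow> complex set set \<Rightarrow> real \<Rightarrow> real \<Rightarrow> (complex \<Rightarrow> real) set" where
  "potentials_P f \<S> \<alpha>\<^sub>1 \<tau> =
     {restrict (\<lambda>z. ln (\<psi> z) - t * ln (deriv_theta f \<tau> z)) (julia_set f) | \<psi> t.
        \<psi> \<in> locally_constant_weights \<S> \<and> ereal t > entire_order f / ereal (\<alpha>\<^sub>1 + \<tau>)}"

definition potentials_T ::
    "(complex \<Rightarrow> complex) \<Rightarrow> complex set set \<Rightarrow> real \<Rightarrow> real \<Rightarrow> real \<Rightarrow> (complex \<Rightarrow> real) set" where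
  "potentials_T f \<S> \<alpha>\<^sub>1 \<alpha>\<^sub>2 \<tau> =
     {restrict (\<lambda>z. h z - t * ln (deriv_theta f \<tau> z)) (julia_set f) | h t.
        (\<exists>M. \<forall>z\<in>julia_set f. \<bar>h z\<bar> \<le> M) \<and> weakly_hoelder f \<S> h \<and>
        ereal t > entire_order f / ereal (\<alpha>\<^sub>1 + \<alpha>\<^sub>2)}"

definition admissible_choice ::
    "(complex \<Rightarrow> complex) \<Rightarrow> complex \<Rightarrow> complex set \<Rightarrow> (real \<Rightarrow> complex) \<Rightarrow>
     real \<Rightarrow> real \<Rightarrow> real \<Rightarrow> bool" where
  "admissible_choice f z0 D \<alpha> \<alpha>\<^sub>1 \<alpha>\<^sub>2 \<tau> \<longleftrightarrow>
     disjoint_type_at f z0 \<and> base_domain f z0 D \<and> cutting_arc f D \<alpha> \<and>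
     rapid_derivative_growth f \<alpha>\<^sub>1 \<alpha>\<^sub>2 \<and> 0 < \<tau> \<and> \<tau> < \<alpha>\<^sub>2 \<and> \<alpha>\<^sub>1 + \<tau> > 0"

end

theory Submission
  imports Defs "HOL-Real_Asymp.Real_Asymp"
begin

text \<open>The witness is \<open>f z = 2 exp (z - 2)\<close>, with \<open>\<alpha>\<^sub>1 = 0\<close>, \<open>\<alpha>\<^sub>2 = 1\<close>, the unit disc as
  base domain and the ray \<open>(-\<infinity>, -1)\<close> as cutting arc. The weight \<open>1\<close> gives a common potential.
  For the other claim, note that \<open>2\<close> is a repelling fixed point, so its preimages
  \<open>2 + 2\<pi>ik\<close> lie in the Julia set; for every admissible choice they lie in pairwise distinct
  fundamental domains, since a path joining two of them inside one fundamental domain would be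
  mapped by \<open>f\<close> to a loop that winds around \<open>0\<close> but avoids the connected unbounded set
  \<open>closure D \<union> \<alpha>\<close> containing \<open>0\<close>. A weight that decays fast enough along these domains
  is not of the form \<open>h + s log |f'|\<^sub>\<theta>\<close> for any bounded \<open>h\<close> and real \<open>s\<close>.\<close>

section \<open>Normality criteria\<close>

text \<open>Among iterates \<open>f ^^ m k\<close>, either one index recurs infinitely often and
  yields a constant subsequence, or \<open>m\<close> tends to infinity and the whole sequence
  inherits the limit \<open>g\<close>.\<close>

lemma normal_family_on_iterates_uniform_limit:
  assumes lim: "uniform_limit U (\<lambda>n. f ^^ n) g sequentially"
  shows "normal_family_on U (range (\<lambda>n. f ^^ n))"
  unfolding normal_family_on_def
proof (intro allI impI)
  fix F :: "nat \<Rightarrow> complex \<Rightarrow> complex"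
  assume "range F \<subseteq> range (\<lambda>n. f ^^ n)"
  then have "\<forall>k. \<exists>n. F k = f ^^ n"
    by blast
  then obtain m where m: "\<And>k. F k = f ^^ m k"
    by metis
  have "\<exists>r :: nat \<Rightarrow> nat. strict_mono r \<and> (\<exists>g. uniform_limit U (\<lambda>k. F (r k)) g sequentially)"
  proof (cases "\<exists>v. infinite {k. m k = v}")
    case True
    then obtain v where "infinite {k. m k = v}"
      by blast
    then obtain r :: "nat \<Rightarrow> nat" where r: "strict_mono r" "\<And>k. r k \<in> {k. m k = v}"
      using infinite_enumerate by blast
    then have "(\<lambda>k. F (r k)) = (\<lambda>k. f ^^ v)"
      using m by auto
    then show ?thesis
      using r(1) uniform_limit_const by metis
  next
    case False
    have "filterlim m at_top sequentially"
      unfolding filterlim_at_top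
    proof
      fix N
      have "{k. m k < N} = (\<Union>v<N. {k. m k = v})"
        by auto
      then have "finite {k. m k < N}"
        using False by auto
      then show "\<forall>\<^sub>F k in sequentially. N \<le> m k"
        unfolding cofinite_eq_sequentially[symmetric] eventually_cofinite by (simp add: not_le)
    qed
    then have "uniform_limit U (\<lambda>k. f ^^ m k) g sequentially"
      using lim by (rule filterlim_compose[rotated])
    then have "uniform_limit U (\<lambda>k. F (id k)) g sequentially"
      by (simp add: m)
    then show ?thesis
      using strict_mono_id by blast
  qed
  then show "\<exists>r. strict_mono r \<and>
      ((\<exists>g. \<forall>K. compact K \<and> K \<subseteq> U \<longrightarrow> uniform_limit K (\<lambda>k. F (r k)) g sequentially) \<or>
       (\<forall>K. compact K \<and> K \<subseteq> U \<longrightarrow>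
          (\<forall>M::real. \<forall>\<^sub>F k in sequentially. \<forall>z\<in>K. norm (F (r k) z) > M)))"
    by (meson uniform_limit_on_subset)
qed

text \<open>The bounded orbit excludes the limit infinity. A finite locally uniform limit bounds a
  subsequence of iterates on a small closed disc, and Cauchy's inequality then bounds the
  derivatives at its centre.\<close>

lemma julia_set_if_derivs_unbounded:
  fixes D :: "nat \<Rightarrow> complex"
  assumes hol: "f holomorphic_on UNIV"
    and deriv: "\<And>n. ((f ^^ n) has_field_derivative D n) (at z)"
    and inf: "filterlim D at_infinity sequentially"
    and bdd: "\<And>n. norm ((f ^^ n) z) \<le> B"
  shows "z \<in> julia_set f"
proof -
  have holn: "(f ^^ n) holomorphic_on A" for n A
  proof (rule holomorphic_on_subset)
    show "(f ^^ n) holomorphic_on UNIV"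
    proof (induction n)
      case (Suc n)
      then show ?case
        using holomorphic_on_compose_gen[OF Suc hol] by (simp add: o_def)
    qed (simp add: id_def)
  qed simp
  have "z \<notin> fatou_set f"
  proof
    assume "z \<in> fatou_set f"
    then obtain U where U: "open U" "z \<in> U" and normal: "normal_family_on U (range (\<lambda>n. f ^^ n))"
      unfolding fatou_set_def by blast
    obtain r :: "nat \<Rightarrow> nat" where r: "strict_mono r" and
      alt: "(\<exists>g. \<forall>K. compact K \<and> K \<subseteq> U \<longrightarrow> uniform_limit K (\<lambda>k. f ^^ r k) g sequentially) \<or>
            (\<forall>K. compact K \<and> K \<subseteq> U \<longrightarrow>
               (\<forall>M::real. \<forall>\<^sub>F k in sequentially. \<forall>z\<in>K. norm ((f ^^ r k) z) > M))"
      using normal unfolding normal_family_on_def by blast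
    obtain e where e: "e > 0" "cball z e \<subseteq> U"
      using U open_contains_cball by blast
    from alt show False
    proof
      assume "\<exists>g. \<forall>K. compact K \<and> K \<subseteq> U \<longrightarrow> uniform_limit K (\<lambda>k. f ^^ r k) g sequentially"
      then obtain g where g: "uniform_limit (cball z e) (\<lambda>k. f ^^ r k) g sequentially"
        using e(2) compact_cball by blast
      have "continuous_on (cball z e) g"
        by (rule uniform_limit_theorem[OF _ g])
           (auto intro!: always_eventually holomorphic_on_imp_continuous_on holn)
      then have "bounded (g ` cball z e)"
        by (intro compact_imp_bounded compact_continuous_image compact_cball)
      then obtain M where M: "\<And>w. w \<in> cball z e \<Longrightarrow> norm (g w) \<le> M"
        unfolding bounded_iff by blast
      have bound: "norm (D (r k)) \<le> (M + 1) / e"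
        if k: "\<forall>w\<in>cball z e. dist ((f ^^ r k) w) (g w) < 1" for k
      proof -
        have nb: "norm ((f ^^ r k) w) \<le> M + 1" if "norm (z - w) = e" for w
        proof -
          have w: "w \<in> cball z e"
            using that by (simp add: dist_norm)
          have "norm ((f ^^ r k) w) \<le> norm (g w) + norm ((f ^^ r k) w - g w)"
            by (rule norm_triangle_sub)
          then show ?thesis
            using k M[OF w] w by (auto simp: dist_norm dest!: bspec[where x=w])
        qed
        have "norm ((deriv ^^ 1) (f ^^ r k) z) \<le> fact 1 * (M + 1) / e ^ 1"
          by (rule Cauchy_inequality) (use e nb in \<open>auto intro: holn holomorphic_on_imp_continuous_on\<close>)
        then show ?thesis
          using DERIV_imp_deriv[OF deriv] by simp
      qed
      have "\<forall>\<^sub>F k in sequentially. norm (D (r k)) \<le> (M + 1) / e"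
        using uniform_limitD[OF g zero_less_one] by eventually_elim (rule bound)
      moreover have "filterlim (\<lambda>k. D (r k)) at_infinity sequentially"
        using inf filterlim_subseq[OF r] by (rule filterlim_compose)
      \<comment> \<open>\<open>max 0\<close> makes the radius positive, as the criterion for
        \<open>at_infinity\<close> demands; the added 1 makes the clash strict.\<close>
      then have "\<forall>\<^sub>F k in sequentially. norm (D (r k)) \<ge> max 0 ((M + 1) / e) + 1"
        using filterlim_at_infinity[of 0 "\<lambda>k. D (r k)" sequentially]
        by (simp add: add_nonneg_pos)
      ultimately have "\<forall>\<^sub>F k in sequentially. False"
        by eventually_elim linarith
      then show False
        by simp
    next
      assume "\<forall>K. compact K \<and> K \<subseteq> U \<longrightarrow>
               (\<forall>M::real. \<forall>\<^sub>F k in sequentially. \<forall>z\<in>K. norm ((f ^^ r k) z) > M)"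
      then have "\<forall>\<^sub>F k in sequentially. \<forall>w\<in>{z}. norm ((f ^^ r k) w) > B"
        using U(2) by (auto dest!: spec[of _ "{z}"])
      then have "\<forall>\<^sub>F k in sequentially. False"
        by eventually_elim (use bdd not_less in blast)
      then show False
        by simp
    qed
  qed
  then show ?thesis
    by (simp add: julia_set_def)
qed

section \<open>The map\<close>

text \<open>The function \<open>c * exp z\<close> with \<open>c = 2 * exp (-2) < exp (-1)\<close>,
  written so that the fixed point 2 is visible. It equals its own derivative, so 2 has multiplier
  2.\<close>

definition exp_map :: "complex \<Rightarrow> complex" where
  "exp_map z = 2 * exp (z - 2)"

lemma norm_exp_map: "norm (exp_map z) = 2 * exp (Re z - 2)"
  by (simp add: exp_map_def norm_mult)

lemma exp_map_nonzero [simp]: "exp_map z \<noteq> 0"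
  by (simp add: exp_map_def)

lemma has_field_derivative_exp_map:
  "(exp_map has_field_derivative exp_map z) (at z within A)"
  unfolding exp_map_def [abs_def] by (auto intro!: derivative_eq_intros)

lemma deriv_exp_map [simp]: "deriv exp_map = exp_map"
  by (auto intro!: DERIV_imp_deriv has_field_derivative_exp_map)

lemma holomorphic_on_exp_map [holomorphic_intros]: "exp_map holomorphic_on A"
  unfolding holomorphic_on_def field_differentiable_def
  using has_field_derivative_exp_map by blast

lemma continuous_on_exp_map: "continuous_on A exp_map"
  by (intro holomorphic_on_imp_continuous_on holomorphic_intros)

lemma exp_map_2: "exp_map 2 = 2"
  by (simp add: exp_map_def)

lemma exp_map_translate: "exp_map (2 + 2 * of_nat k * of_real pi * \<i>) = 2"
proof -
  have "exp (2 * of_nat k * of_real pi * \<i>) = (1::complex)"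
    unfolding exp_eq_1 by (auto intro!: exI[of _ "int k"])
  then show ?thesis
    by (simp add: exp_map_def)
qed

section \<open>Transcendence, finite order and derivative growth\<close>

lemma transcendental_entire_exp_map: "transcendental_entire exp_map"
  unfolding transcendental_entire_def
proof (intro conjI notI)
  show "exp_map holomorphic_on UNIV"
    by (intro holomorphic_intros)
next
  assume "\<exists>p. \<forall>z. exp_map z = poly p z"
  then obtain p where p: "\<And>z. exp_map z = poly p z"
    by blast
  then have "exp_map = poly p"
    by blast
  then have "poly (pderiv p) z = poly p z" for z
    using DERIV_unique[OF poly_DERIV] has_field_derivative_exp_map by metis
  then have "pderiv p = p"
    by (intro poly_eq_poly_eq_iff[THEN iffD1] ext)
  \<comment> \<open>Natural subtraction truncates, so this forces degree 0; a constant has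
    derivative 0, but \<open>exp_map\<close> has no zeros.\<close>
  then have "degree p = degree p - 1"
    using degree_pderiv[of p] by simp
  then have "pderiv p = 0"
    by (simp add: pderiv_eq_0_iff)
  then show False
    using \<open>pderiv p = p\<close> p[of 0] by simp
qed

text \<open>Bounds by 0 and 1 suffice: finiteness is what \<open>class_F\<close> asks for and turns
  the extended-real thresholds into real quotients, and the sign serves to compare the thresholds of
  the two families.\<close>

lemma entire_order_exp_map:
  obtains \<rho> where "entire_order exp_map = ereal \<rho>" "\<rho> \<ge> 0"
proof -
  have ev: "\<forall>\<^sub>F z :: complex in at_infinity. norm z \<ge> 3"
    by (auto simp: eventually_at_infinity)
  have "entire_order exp_map \<le> ereal 1"
    unfolding entire_order_def
  proof (rule Limsup_bounded, use ev in eventually_elim)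
    fix z :: complex
    assume z: "norm z \<ge> 3"
    have "ln (ln (norm (exp_map z))) / ln (norm z) \<le> 1" if gt: "norm (exp_map z) > 1"
    proof -
      \<comment> \<open>Since \<open>ln 2 - 2 < 0\<close>, the inner logarithm is at most
        \<open>Re z \<le> norm z\<close>.\<close>
      have "ln (norm (exp_map z)) = ln 2 + (Re z - 2)"
        unfolding norm_exp_map by (subst ln_mult) auto
      also have "\<dots> \<le> norm z"
        using complex_Re_le_cmod[of z] ln_le_minus_one[of "2::real"] by simp
      finally have "ln (ln (norm (exp_map z))) \<le> ln (norm z)"
        using gt z by (intro ln_mono) auto
      moreover have "ln (norm z) > 0"
        using z by (intro ln_gt_zero) linarith
      ultimately show ?thesis
        by (simp add: divide_le_eq)
    qed
    then show "(if norm (exp_map z) > 1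
        then ereal (ln (ln (norm (exp_map z))) / ln (norm z)) else - \<infinity>) \<le> ereal 1"
      by auto
  qed
  moreover have "entire_order exp_map \<ge> 0"
  proof (rule ccontr)
    assume "\<not> ?thesis"
    then have "entire_order exp_map < 0"
      by simp
    note Limsup_lessD[OF this[unfolded entire_order_def]]
    then obtain b where b: "\<And>z. norm z \<ge> b \<Longrightarrow> (if norm (exp_map z) > 1
        then ereal (ln (ln (norm (exp_map z))) / ln (norm z)) else - \<infinity>) < 0"
      unfolding eventually_at_infinity by blast
    \<comment> \<open>At real \<open>x \<ge> 3\<close> the modulus is at least \<open>exp 1\<close>,
      so the iterated logarithm is nonnegative; such points occur arbitrarily far out.\<close>
    define x where "x = max b 3"
    have x: "x \<ge> 3" "norm (complex_of_real x) \<ge> b"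
      by (auto simp: x_def)
    have "exp 1 \<le> exp (x - 2)"
      using x by simp
    also have "\<dots> \<le> norm (exp_map (of_real x))"
      by (simp add: norm_exp_map)
    finally have ge: "exp 1 \<le> norm (exp_map (of_real x))" .
    then have "ln (norm (exp_map (of_real x))) \<ge> 1"
      by (metis exp_gt_zero ln_exp ln_mono order_less_le_trans)
    then have "ln (ln (norm (exp_map (of_real x)))) / ln (norm (complex_of_real x)) \<ge> 0"
      using x by (intro divide_nonneg_nonneg ln_ge_zero) auto
    moreover have "norm (exp_map (of_real x)) > 1"
      using ge by (metis exp_gt_one less_le_trans zero_less_one)
    ultimately show False
      using b[OF x(2)] by (simp add: less_ereal.simps zero_ereal_def del: ereal_eq_0)
  qed
  ultimately show ?thesis
    using that by (cases "entire_order exp_map") (auto simp: zero_ereal_def simp del: ereal_eq_0)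
qed

text \<open>As the derivative is the map itself, equality holds with constant 1 for
  \<open>z \<noteq> 0\<close>; at 0 the convention \<open>0 powr 0 = 0\<close> makes the lower bound
  vanish.\<close>

lemma rapid_derivative_growth_exp_map: "rapid_derivative_growth exp_map 0 1"
  unfolding rapid_derivative_growth_def
  by (auto intro!: exI[of _ 1] simp: powr_def)

section \<open>Singular values\<close>

text \<open>Suppose the map tends to \<open>a \<noteq> 0\<close> along \<open>\<gamma>\<close>.
  Subtracting a continuous logarithm of the image from \<open>\<gamma>\<close> leaves a continuous
  function with values in a translate of \<open>2 pi i Z\<close>, hence a constant, so
  \<open>\<gamma>\<close> would converge. The value 0 is approached along the negative real
  axis.\<close>

lemma asymptotic_values_exp_map: "asymptotic_values exp_map = {0}"
proof (intro set_eqI iffI)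
  fix a
  assume "a \<in> asymptotic_values exp_map"
  then obtain \<gamma> :: "real \<Rightarrow> complex" where cont: "continuous_on {0..} \<gamma>"
    and inf: "filterlim \<gamma> at_infinity at_top" and lim: "((\<lambda>t. exp_map (\<gamma> t)) \<longlongrightarrow> a) at_top"
    unfolding asymptotic_values_def by blast
  have "a = 0"
  proof (rule ccontr)
    assume a: "a \<noteq> 0"
    define q where "q t = exp_map (\<gamma> t) / a" for t
    have qlim: "(q \<longlongrightarrow> 1) at_top"
      using tendsto_divide[OF lim tendsto_const a] a by (simp add: q_def[abs_def])
    then have "\<forall>\<^sub>F t in at_top. dist (q t) 1 < 1"
      by (rule tendstoD) simp
    then obtain T0 where T0: "\<And>t. t \<ge> T0 \<Longrightarrow> dist (q t) 1 < 1"
      by (auto simp: eventually_at_top_linorder)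
    define T where "T = max T0 0"
    \<comment> \<open>Near 1 the quotient avoids the branch cut, so the principal logarithm is
      continuous along the tail of the path.\<close>
    have nonpos: "q t \<notin> \<real>\<^sub>\<le>\<^sub>0" if "t \<in> {T..}" for t
    proof
      assume "q t \<in> \<real>\<^sub>\<le>\<^sub>0"
      then have "Re (q t) \<le> 0"
        by (simp add: complex_nonpos_Reals_iff)
      then have "1 \<le> \<bar>Re (q t - 1)\<bar>"
        by simp
      also have "\<dots> \<le> dist (q t) 1"
        unfolding dist_norm by (rule abs_Re_le_cmod)
      finally show False
        using T0[of t] that by (simp add: T_def)
    qed
    have cont': "continuous_on {T..} \<gamma>"
      using cont by (rule continuous_on_subset) (auto simp: T_def)
    have contq: "continuous_on {T..} q"
      unfolding q_def[abs_def] exp_map_def using a by (intro continuous_intros cont') auto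
    define g where "g t = \<gamma> t - Ln (q t)" for t
    have contg: "continuous_on {T..} g"
      unfolding g_def[abs_def] using nonpos by (intro continuous_intros cont' contq) auto
    have expg: "exp (g t) = a * exp 2 / 2" if "t \<in> {T..}" for t
      using a by (simp add: g_def exp_diff exp_Ln q_def exp_map_def field_simps)
    have "g constant_on {T..}"
    proof (rule continuous_discrete_range_constant[OF _ contg])
      show "connected {T..}"
        by simp
      fix x
      assume x: "x \<in> {T..}"
      show "\<exists>e>0. \<forall>y. y \<in> {T..} \<and> g y \<noteq> g x \<longrightarrow> e \<le> norm (g y - g x)"
      proof (intro exI[of _ "2 * pi"] conjI allI impI)
        fix y
        assume y: "y \<in> {T..} \<and> g y \<noteq> g x"
        then have "exp (g y) = exp (g x)"
          using x expg[of x] expg[of y] by metis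
        then obtain n :: int where n: "g y = g x + (of_int (2 * n) * pi) * \<i>"
          by (auto simp: exp_eq)
        then have "n \<noteq> 0"
          using y by auto
        then have "1 \<le> \<bar>real_of_int n\<bar>"
          by linarith
        moreover have "norm (g y - g x) = 2 * pi * \<bar>real_of_int n\<bar>"
          by (simp add: n norm_mult)
        ultimately show "2 * pi \<le> norm (g y - g x)"
          by simp
      qed simp
    qed
    then obtain c where c: "\<And>t. t \<in> {T..} \<Longrightarrow> g t = c"
      unfolding constant_on_def by blast
    have "((\<lambda>t. Ln (q t) + c) \<longlongrightarrow> Ln 1 + c) at_top"
      by (intro tendsto_intros qlim) auto
    moreover have "\<forall>\<^sub>F t in at_top. Ln (q t) + c = \<gamma> t"
      using eventually_ge_at_top[of T]
    proof eventually_elim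
      case (elim t)
      then have "g t = c"
        using c by simp
      then show ?case
        by (auto simp: g_def)
    qed
    ultimately have "(\<gamma> \<longlongrightarrow> Ln 1 + c) at_top"
      by (rule Lim_transform_eventually)
    then show False
      using inf not_tendsto_and_filterlim_at_infinity trivial_limit_at_top_linorder by blast
  qed
  then show "a \<in> {0}"
    by simp
next
  fix a :: complex
  assume "a \<in> {0}"
  have "filterlim (\<lambda>t. norm (- complex_of_real t)) at_top at_top"
    by (simp add: filterlim_abs_real)
  then have "filterlim (\<lambda>t. - complex_of_real t) at_infinity at_top"
    by (rule filterlim_norm_at_top_imp_at_infinity)
  moreover have "((\<lambda>t. exp_map (- complex_of_real t)) \<longlongrightarrow> 0) at_top"
  proof (rule tendsto_norm_zero_cancel)
    have "((\<lambda>t::real. 2 * exp (- t - 2)) \<longlongrightarrow> 0) at_top"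
      by real_asymp
    then show "((\<lambda>t. norm (exp_map (- complex_of_real t))) \<longlongrightarrow> 0) at_top"
      by (simp add: norm_exp_map)
  qed
  moreover have "continuous_on {0..} (\<lambda>t. - complex_of_real t)"
    by (intro continuous_intros)
  ultimately show "a \<in> asymptotic_values exp_map"
    using \<open>a \<in> {0}\<close> unfolding asymptotic_values_def by blast
qed

lemma sing_inv_exp_map: "sing_inv exp_map = {0}"
  by (simp add: sing_inv_def critical_values_def asymptotic_values_exp_map)

section \<open>The attracting fixed point\<close>

text \<open>On the closed unit disc the derivative, being the map itself, has modulus at most
  \<open>q = 2 / e < 1\<close>; so the map contracts the disc into itself and Banach's theorem
  applies, with geometric convergence. The bound on \<open>z0\<close> later gives a multiplier of
  modulus below 1.\<close>

lemma exp_map_contraction_unit_disc: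
  obtains q z0 where "0 \<le> q" "q < 1" "norm z0 \<le> q" "exp_map z0 = z0"
    "\<And>z. z \<in> cball 0 1 \<Longrightarrow> norm (exp_map z) \<le> q"
    "uniform_limit (cball 0 1) (\<lambda>n. exp_map ^^ n) (\<lambda>_. z0) sequentially"
proof -
  define q :: real where "q = 2 * exp (- 1)"
  \<comment> \<open>From \<open>exp (1/2) \<ge> 3/2\<close> follows \<open>e \<ge> 9/4 > 2\<close>,
    that is \<open>q < 1\<close>.\<close>
  have "(9/4 :: real) = (3/2)\<^sup>2"
    by (simp add: power2_eq_square)
  also have "\<dots> \<le> (exp (1/2))\<^sup>2"
    using exp_ge_add_one_self[of "1/2::real"] by (intro power_mono) auto
  also have "\<dots> = exp 1"
    by (simp flip: exp_double)
  finally have "q < 1"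
    by (simp add: q_def exp_minus field_simps)
  have "q \<ge> 0"
    by (simp add: q_def)
  have q: "norm (exp_map z) \<le> q" if "z \<in> cball 0 1" for z
  proof -
    have "Re z \<le> 1"
      using that complex_Re_le_cmod[of z] by simp
    then show ?thesis
      by (simp add: norm_exp_map q_def)
  qed
  have lip: "norm (exp_map x - exp_map y) \<le> q * norm (x - y)"
    if "x \<in> cball 0 1" "y \<in> cball 0 1" for x y
    using that by (intro field_differentiable_bound[OF convex_cball has_field_derivative_exp_map q])
  have self: "exp_map z \<in> cball 0 1" if "z \<in> cball 0 1" for z
    using q[OF that] \<open>q < 1\<close> by simp
  have "\<exists>!x. x \<in> cball 0 1 \<and> exp_map x = x"
    by (rule Banach_fix[where c=q])
       (use \<open>q \<ge> 0\<close> \<open>q < 1\<close> self lip in \<open>auto simp: dist_norm complete_eq_closed\<close>)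
  then obtain z0 where z0: "z0 \<in> cball 0 1" "exp_map z0 = z0"
    by blast
  \<comment> \<open>The factor 2 is the diameter of the disc.\<close>
  have iter: "(exp_map ^^ n) z \<in> cball 0 1 \<and> norm ((exp_map ^^ n) z - z0) \<le> q ^ n * 2"
    if z: "z \<in> cball 0 1" for z n
  proof (induction n)
    case 0
    then show ?case
      using z z0(1) norm_triangle_ineq4[of z z0] by simp
  next
    case (Suc n)
    have "norm (exp_map ((exp_map ^^ n) z) - exp_map z0) \<le> q * norm ((exp_map ^^ n) z - z0)"
      using Suc z0 by (intro lip) auto
    also have "\<dots> \<le> q * (q ^ n * 2)"
      using Suc \<open>q \<ge> 0\<close> by (intro mult_left_mono) auto
    finally show ?case
      using Suc self z0 by simp
  qed
  have "(\<lambda>n. q ^ n * 2) \<longlonglongrightarrow> 0"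
    using \<open>q \<ge> 0\<close> \<open>q < 1\<close> by (auto intro!: tendsto_eq_intros LIMSEQ_realpow_zero)
  then have "uniform_limit (cball 0 1) (\<lambda>n. exp_map ^^ n) (\<lambda>_. z0) sequentially"
    unfolding uniform_limit_iff
  proof (intro allI impI)
    fix e :: real
    assume lim: "(\<lambda>n. q ^ n * 2) \<longlonglongrightarrow> 0" and "e > 0"
    have "\<forall>\<^sub>F n in sequentially. q ^ n * 2 < e"
      using order_tendstoD(2)[OF lim \<open>e > 0\<close>] .
    then show "\<forall>\<^sub>F n in sequentially. \<forall>x\<in>cball 0 1. dist ((exp_map ^^ n) x) z0 < e"
    proof (rule eventually_mono, intro ballI)
      fix n and z :: complex
      assume "q ^ n * 2 < e" "z \<in> cball 0 1"
      then show "dist ((exp_map ^^ n) z) z0 < e"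
        using iter[of z n] by (simp add: dist_norm)
    qed
  qed
  then show ?thesis
    using that \<open>q \<ge> 0\<close> \<open>q < 1\<close> q z0 by metis
qed

text \<open>The closed unit disc is connected and attracted to \<open>z0\<close>, so it lies in the
  immediate basin; its image lies in the disc of radius \<open>q < 1\<close>. That 0 is off the
  Julia set keeps the metric \<open>|z|^(-\<tau>) |dz|\<close> meaningful there.\<close>

lemma base_domain_exp_map:
  obtains z0 where "disjoint_type_at exp_map z0" "base_domain exp_map z0 (ball 0 1)"
    "0 \<notin> julia_set exp_map"
proof -
  obtain q z0 where q: "0 \<le> q" "q < 1" "norm z0 \<le> q" and fixed: "exp_map z0 = z0"
    and bound: "\<And>z. z \<in> cball 0 1 \<Longrightarrow> norm (exp_map z) \<le> q"
    and lim: "uniform_limit (cball 0 1) (\<lambda>n. exp_map ^^ n) (\<lambda>_. z0) sequentially"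
    using exp_map_contraction_unit_disc by blast
  have "cball 0 1 \<subseteq> {z. (\<lambda>n. (exp_map ^^ n) z) \<longlonglongrightarrow> z0}"
    using tendsto_uniform_limitI[OF lim] by auto
  then have basin: "cball 0 1 \<subseteq> immediate_basin exp_map z0"
    unfolding immediate_basin_def using q
    by (intro connected_component_maximal) (auto simp: convex_connected)
  have disjoint: "disjoint_type_at exp_map z0"
    unfolding disjoint_type_at_def attracting_fixed_point_def sing_inv_exp_map
    using q fixed basin by (auto intro!: exI[of _ "{0}"])
  moreover have "base_domain exp_map z0 (ball 0 1)"
    unfolding base_domain_def sing_inv_exp_map
  proof (intro conjI)
    show "analytic_jordan_curve (frontier (ball 0 1))"
      unfolding analytic_jordan_curve_def
      by (rule exI[of _ UNIV], rule exI[of _ "\<lambda>z. z"]) auto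
    have "closure (exp_map ` ball 0 1) \<subseteq> cball 0 q"
      using bound by (intro closure_minimal) auto
    also have "\<dots> \<subseteq> ball 0 1"
      using q by auto
    finally show "closure (exp_map ` ball 0 1) \<subseteq> ball 0 1" .
  qed (use basin in \<open>auto simp: convex_connected convex_imp_simply_connected\<close>)
  moreover have "0 \<in> fatou_set exp_map"
    unfolding fatou_set_def
    using normal_family_on_iterates_uniform_limit[OF uniform_limit_on_subset[OF lim ball_subset_cball]]
    by (auto intro!: exI[of _ "ball 0 1"] simp: convex_connected)
  ultimately show ?thesis
    using that by (simp add: julia_set_def)
qed

text \<open>The modulus of the map increases with \<open>Re z\<close> alone and is below 1 at the
  point 1, so every tract lies in the closed half-plane \<open>Re z \<ge> 1\<close>, away from the
  ray on the negative axis.\<close>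

lemma cutting_arc_exp_map: "cutting_arc exp_map (ball 0 1) (\<lambda>t. - 1 - of_real t)"
  unfolding cutting_arc_def
proof (intro conjI)
  have closed: "closed {z. 1 \<le> Re z}"
    by (rule closed_halfspace_Re_ge)
  have "T \<subseteq> {z. 1 \<le> Re z}" if "T \<in> tracts exp_map (ball 0 1)" for T
  proof
    fix z
    assume "z \<in> T"
    then have "1 < norm (exp_map z)"
      using in_components_subset[OF that[unfolded tracts_def]] by auto
    moreover obtain q where "q < 1" "\<And>z. z \<in> cball 0 1 \<Longrightarrow> norm (exp_map z) \<le> q"
      using exp_map_contraction_unit_disc by metis
    then have "norm (exp_map 1) < 1"
      by (metis cball_trivial dist_0_norm le_less_trans mem_cball norm_one order_refl)
    ultimately have "2 * exp (Re 1 - 2) < 2 * exp (Re z - 2)"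
      unfolding norm_exp_map by (rule less_trans[rotated])
    then show "z \<in> {z. 1 \<le> Re z}"
      by simp
  qed
  then have "(\<Union>T\<in>tracts exp_map (ball 0 1). closure T) \<subseteq> {z. 1 \<le> Re z}"
    using closure_minimal[OF _ closed] by blast
  then show "(\<lambda>t. - 1 - complex_of_real t) ` {0<..} \<inter>
      (\<Union>T\<in>tracts exp_map (ball 0 1). closure T) = {}"
    by fastforce
  show "(\<lambda>t. - 1 - complex_of_real t) ` {0<..} \<subseteq> - closure (ball 0 1)"
  proof clarsimp
    fix t :: real
    assume "0 < t" "cmod (- 1 - complex_of_real t) \<le> 1"
    then show False
      using abs_Re_le_cmod[of "- 1 - complex_of_real t"] by simp
  qed
  show "\<exists>p\<in>frontier (ball 0 1). ((\<lambda>t. - 1 - complex_of_real t) \<longlongrightarrow> p) (at_right 0)"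
    by (rule bexI[of _ "-1"]) (auto intro!: tendsto_eq_intros)
  show "filterlim (\<lambda>t. - 1 - complex_of_real t) at_infinity at_top"
  proof (rule filterlim_norm_at_top_imp_at_infinity)
    show "filterlim (\<lambda>t. norm (- 1 - complex_of_real t)) at_top at_top"
    proof (rule filterlim_at_top_mono[OF filterlim_ident], rule always_eventually, rule allI)
      fix t
      show "t \<le> norm (- 1 - complex_of_real t)"
        using abs_Re_le_cmod[of "- 1 - complex_of_real t"] by simp
    qed
  qed
qed (auto intro!: continuous_intros inj_onI)

section \<open>Fundamental domains\<close>

text \<open>The orbit is 2 from the first step on. Since the derivative equals the map, each factor
  in the chain rule is 2, the first one included.\<close>

lemma preimage_2_in_julia_set:
  assumes "exp_map z = 2"
  shows "z \<in> julia_set exp_map"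
proof -
  have iter: "(exp_map ^^ Suc n) z = 2" for n
    by (induction n) (use assms in \<open>auto simp: exp_map_2\<close>)
  show ?thesis
  proof (rule julia_set_if_derivs_unbounded)
    show "exp_map holomorphic_on UNIV"
      by (intro holomorphic_intros)
    show "((exp_map ^^ n) has_field_derivative 2 ^ n) (at z)" for n
    proof (induction n)
      case (Suc n)
      then have "(exp_map \<circ> (exp_map ^^ n) has_field_derivative exp_map ((exp_map ^^ n) z) * 2 ^ n) (at z)"
        by (intro DERIV_chain has_field_derivative_exp_map)
      then show ?case
        using iter[of n] by (simp add: o_def)
    qed (simp add: id_def)
    have "filterlim (\<lambda>n. norm (2 ^ n :: complex)) at_top sequentially"
      unfolding norm_power by real_asymp
    then show "filterlim (\<lambda>n. 2 ^ n :: complex) at_infinity sequentially"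
      by (rule filterlim_norm_at_top_imp_at_infinity)
    show "norm ((exp_map ^^ n) z) \<le> max 2 (norm z)" for n
      using iter by (cases n) auto
  qed
qed

lemma fundamental_domains_eqI:
  assumes "S \<in> fundamental_domains f D \<alpha>" "S' \<in> fundamental_domains f D \<alpha>" "z \<in> S" "z \<in> S'"
  shows "S = S'"
proof -
  obtain T T' where T: "T \<in> tracts f D" "S \<in> components (T - f -` (\<alpha> ` {0<..}))"
    "T' \<in> tracts f D" "S' \<in> components (T' - f -` (\<alpha> ` {0<..}))"
    using assms unfolding fundamental_domains_def by blast
  then have "z \<in> T" "z \<in> T'"
    using assms(3,4) in_components_subset by blast+
  then have "T = T'"
    using T(1,3) unfolding tracts_def by (meson components_eq disjoint_iff)
  then show ?thesis
    using T(2,4) assms(3,4) by (meson components_eq disjoint_iff)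
qed

text \<open>Adding the landing point \<open>p\<close> turns the arc into a continuous image of
  \<open>[0, \<infinity>)\<close> that meets \<open>closure D\<close>; its escape to infinity makes
  this image closed.\<close>

lemma closed_connected_domain_Un_arc:
  assumes D: "connected D" and arc: "cutting_arc f D \<alpha>"
  shows "closed (closure D \<union> \<alpha> ` {0<..})" "connected (closure D \<union> \<alpha> ` {0<..})"
proof -
  obtain p where p: "p \<in> frontier D" "(\<alpha> \<longlongrightarrow> p) (at_right 0)"
    and cont: "continuous_on {0<..} \<alpha>" and inf: "filterlim \<alpha> at_infinity at_top"
    using arc unfolding cutting_arc_def by blast
  define \<beta> where "\<beta> t = (if t = 0 then p else \<alpha> t)" for t
  have "p \<in> closure D"
    using p(1) by (simp add: frontier_def)
  then have eq: "closure D \<union> \<alpha> ` {0<..} = closure D \<union> \<beta> ` {0..}"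
    by (auto simp: \<beta>_def image_iff less_le)
  have cont\<beta>: "continuous_on {0..} \<beta>"
    unfolding continuous_on_eq_continuous_within
  proof
    fix t :: real
    assume t: "t \<in> {0..}"
    show "continuous (at t within {0..}) \<beta>"
    proof (cases "t = 0")
      case True
      have "(\<beta> \<longlongrightarrow> p) (at_right 0)"
        using p(2) by (rule Lim_transform_eventually)
          (auto simp: \<beta>_def eventually_at_filter)
      then show ?thesis
        by (simp add: True continuous_within \<beta>_def at_within_Ici_at_right)
    next
      case False
      then have "t > 0"
        using t by simp
      moreover have "continuous_on {0<..} \<beta>"
        using cont by (rule continuous_on_eq) (simp add: \<beta>_def)
      ultimately have "isCont \<beta> t"
        using continuous_on_eq_continuous_at[of "{0<..}" \<beta>] by auto
      then show ?thesis
        by (rule continuous_at_imp_continuous_at_within)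
    qed
  qed
  have "closed (\<beta> ` {0..})"
    unfolding closure_subset_eq[symmetric]
  proof (rule subsetI)
    fix y
    assume y: "y \<in> closure (\<beta> ` {0..})"
    have "\<forall>\<^sub>F t in at_top. norm (\<alpha> t) \<ge> norm y + 1"
      using inf filterlim_at_infinity[of 0 \<alpha> at_top] by (simp add: add_nonneg_pos)
    then obtain M where M: "\<And>t. t \<ge> M \<Longrightarrow> norm (\<alpha> t) \<ge> norm y + 1"
      by (auto simp: eventually_at_top_linorder)
    \<comment> \<open>\<open>N \<ge> 1\<close> ensures that beyond \<open>N\<close> the parameter is
      nonzero and \<open>\<beta>\<close> agrees with \<open>\<alpha>\<close>; there
      \<open>\<beta>\<close> stays away from \<open>y\<close>, so \<open>y\<close> can only come
      from the compact piece over \<open>{0..N}\<close>.\<close>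
    define N where "N = max M 1"
    have "\<beta> t \<in> \<beta> ` {0..N} \<union> - ball 0 (norm y + 1)" if "t \<ge> 0" for t
    proof (cases "t \<le> N")
      case False
      then have "t \<ge> M" "t \<noteq> 0"
        by (auto simp: N_def)
      then have "\<beta> t \<notin> ball 0 (norm y + 1)"
        using M[of t] by (simp add: \<beta>_def)
      then show ?thesis
        by blast
    qed (use that in auto)
    then have "\<beta> ` {0..} \<subseteq> \<beta> ` {0..N} \<union> - ball 0 (norm y + 1)"
      by blast
    moreover have "compact (\<beta> ` {0..N})"
      by (intro compact_continuous_image continuous_on_subset[OF cont\<beta>]) auto
    then have "closed (\<beta> ` {0..N} \<union> - ball 0 (norm y + 1))"
      by (intro closed_Un) (auto intro: compact_imp_closed)
    ultimately have "y \<in> \<beta> ` {0..N} \<union> - ball 0 (norm y + 1)"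
      using y closure_minimal by blast
    then show "y \<in> \<beta> ` {0..}"
      by auto
  qed
  then show "closed (closure D \<union> \<alpha> ` {0<..})"
    unfolding eq by (intro closed_Un) auto
  have "p \<in> \<beta> ` {0..}"
    by (auto simp: \<beta>_def image_iff)
  moreover have "connected (\<beta> ` {0..})"
    by (intro connected_continuous_image cont\<beta>) simp
  ultimately show "connected (closure D \<union> \<alpha> ` {0<..})"
    unfolding eq using D \<open>p \<in> closure D\<close> by (intro connected_Un connected_imp_connected_closure) auto
qed

text \<open>A path in \<open>S\<close> from \<open>z\<close> to \<open>w\<close> is, up to a shift,
  a lift of its image loop through \<open>exp\<close>, so the winding number of the loop about 0 is
  \<open>(w - z) / (2 pi i)\<close>. It vanishes because 0 belongs to \<open>E\<close>, which is
  connected, unbounded and disjoint from the loop.\<close>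

lemma exp_map_inj_on_fundamental_domain:
  assumes D: "connected D" "0 \<in> D" and arc: "cutting_arc exp_map D \<alpha>"
    and S: "S \<in> fundamental_domains exp_map D \<alpha>"
  shows "inj_on exp_map S"
proof (rule inj_onI)
  fix z w
  assume z: "z \<in> S" and w: "w \<in> S" and eq: "exp_map z = exp_map w"
  define E where "E = closure D \<union> \<alpha> ` {0<..}"
  have E: "closed E" "connected E"
    using closed_connected_domain_Un_arc[OF D(1) arc] by (auto simp: E_def)
  have preimage_open: "open (exp_map -` A)" if "open A" for A
    using that continuous_on_exp_map by (rule open_vimage)
  obtain T where T: "T \<in> components (exp_map -` (- closure D))"
    "S \<in> components (T - exp_map -` (\<alpha> ` {0<..}))"
    using S unfolding fundamental_domains_def tracts_def by blast
  have TS: "T \<subseteq> exp_map -` (- closure D)" "S \<subseteq> T - exp_map -` (\<alpha> ` {0<..})"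
    using T in_components_subset by blast+
  have "open T"
    using T(1) by (rule open_components[rotated]) (auto intro: preimage_open)
  \<comment> \<open>The arc alone is not closed, as it lands on the frontier of \<open>D\<close>;
    \<open>E\<close> is closed, and removing its preimage gives the same set.\<close>
  moreover have "T - exp_map -` (\<alpha> ` {0<..}) = T \<inter> exp_map -` (- E)"
    using TS(1) by (auto simp: E_def)
  ultimately have "open (T - exp_map -` (\<alpha> ` {0<..}))"
    using E(1) by (auto intro!: open_Int preimage_open)
  then have "open S" "connected S"
    using T(2) open_components in_components_connected by blast+
  then have "path_connected S"
    by (simp add: connected_open_path_connected)
  then obtain g where g: "path g" "path_image g \<subseteq> S" "pathstart g = z" "pathfinish g = w"
    using z w unfolding path_connected_def by blast
  \<comment> \<open>The shift absorbs the factor: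
    \<open>2 * exp (u - 2) = exp (u - (2 - Ln 2))\<close>.\<close>
  define p where "p t = g t - (2 - Ln 2)" for t
  have "path p"
    using g(1) unfolding path_def p_def[abs_def] by (intro continuous_intros)
  have exp_p: "exp (p t) = exp_map (g t)" for t
    by (simp add: p_def exp_diff exp_map_def)
  define l where "l = exp \<circ> p"
  have l: "path l" "pathfinish l = pathstart l"
    using \<open>path p\<close> g(3,4) eq exp_p
    by (auto simp: l_def pathstart_def pathfinish_def intro!: path_continuous_image continuous_intros)
  have "E \<inter> path_image l = {}"
    using g(2) TS by (force simp: path_image_def l_def exp_p E_def)
  note const = winding_number_eq[OF l _ _ E(2) this]
  \<comment> \<open>The winding number is 0 far out, and the arc supplies a point of
    \<open>E\<close> that far out.\<close>
  obtain B where B: "\<And>y. B \<le> norm y \<Longrightarrow> winding_number l y = 0"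
    using winding_number_zero_at_infinity[OF l] by blast
  have "filterlim \<alpha> at_infinity at_top"
    using arc by (simp add: cutting_arc_def)
  then have "\<forall>\<^sub>F t in at_top. norm (\<alpha> t) \<ge> \<bar>B\<bar> + 1"
    using filterlim_at_infinity[of 0 \<alpha> at_top] by (simp add: add_nonneg_pos)
  moreover have "\<forall>\<^sub>F t in at_top. t > (0::real)"
    by (rule eventually_gt_at_top)
  ultimately have "\<forall>\<^sub>F t in at_top. t > 0 \<and> norm (\<alpha> t) \<ge> \<bar>B\<bar> + 1"
    by eventually_elim simp
  then obtain t where t: "t > 0" "norm (\<alpha> t) \<ge> \<bar>B\<bar> + 1"
    using eventually_happens'[OF trivial_limit_at_top_linorder] by blast
  have "0 \<in> E" "\<alpha> t \<in> E"
    using D(2) t(1) closure_subset by (auto simp: E_def)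
  then have "winding_number l 0 = 0"
    using const[of 0 "\<alpha> t"] B[of "\<alpha> t"] t(2) by simp
  then show "z = w"
    using winding_number_compose_exp[OF \<open>path p\<close>] g(3,4)
    by (simp add: l_def p_def pathfinish_def pathstart_def)
qed

text \<open>The basin of \<open>z0\<close> misses 2, a fixed point with multiplier 2, so 2 is
  outside \<open>closure D\<close> and its preimages lie in tracts. As 2 is its own preimage, it
  lies in a tract itself and hence off the arc.\<close>

lemma preimage_2_in_fundamental_domain:
  assumes adm: "disjoint_type_at exp_map z0" "base_domain exp_map z0 D" "cutting_arc exp_map D \<alpha>"
    and z: "exp_map z = 2"
  shows "z \<in> \<Union>(fundamental_domains exp_map D \<alpha>)"
proof -
  have iter: "(exp_map ^^ n) 2 = 2" for n
    by (induction n) (auto simp: exp_map_2)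
  have "2 \<notin> closure D"
  proof
    assume "2 \<in> closure D"
    then have "2 \<in> {z. (\<lambda>n. (exp_map ^^ n) z) \<longlonglongrightarrow> z0}"
      using adm(2) connected_component_subset
      unfolding base_domain_def immediate_basin_def by blast
    then have "z0 = 2"
      by (simp add: iter LIMSEQ_const_iff)
    then show False
      using adm(1) by (simp add: disjoint_type_at_def attracting_fixed_point_def exp_map_2)
  qed
  then have tract: "\<exists>T\<in>tracts exp_map D. w \<in> T" if "exp_map w = 2" for w
    using that \<open>2 \<notin> closure D\<close> Union_components[of "exp_map -` (- closure D)"]
    unfolding tracts_def by (metis ComplI UnionE vimageI)
  then obtain T where T: "T \<in> tracts exp_map D" "z \<in> T"
    using z by blast
  obtain T' where "T' \<in> tracts exp_map D" "2 \<in> T'"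
    using tract exp_map_2 by blast
  then have "2 \<notin> \<alpha> ` {0<..}"
    using adm(3) closure_subset unfolding cutting_arc_def by blast
  then have "z \<in> T - exp_map -` (\<alpha> ` {0<..})"
    using T z by auto
  then obtain S where "S \<in> components (T - exp_map -` (\<alpha> ` {0<..}))" "z \<in> S"
    by (metis Union_components UnionE)
  then show ?thesis
    using T(1) unfolding fundamental_domains_def by blast
qed

section \<open>Potentials\<close>

lemma weakly_hoelder_const: "weakly_hoelder f \<S> (\<lambda>_. c)"
  unfolding weakly_hoelder_def
  by (rule exI[of _ 1], simp, rule exI[of _ 1], simp, rule exI[of _ "1/2"], simp)

text \<open>The weight 1 corresponds to the constant \<open>h = ln 1\<close>. One exponent serves
  both families: \<open>\<rho> \<ge> 0\<close> and \<open>\<tau> < \<alpha>\<^sub>2\<close> make the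
  threshold of the first at least that of the second.\<close>

lemma potentials_Int_nonempty:
  assumes \<rho>: "entire_order f = ereal \<rho>" "\<rho> \<ge> 0" and \<alpha>: "\<alpha>\<^sub>1 + \<tau> > 0" "\<tau> < \<alpha>\<^sub>2"
  shows "potentials_P f \<S> \<alpha>\<^sub>1 \<tau> \<inter> potentials_T f \<S> \<alpha>\<^sub>1 \<alpha>\<^sub>2 \<tau> \<noteq> {}"
proof -
  define t where "t = \<rho> / (\<alpha>\<^sub>1 + \<tau>) + 1"
  have "\<rho> / (\<alpha>\<^sub>1 + \<alpha>\<^sub>2) \<le> \<rho> / (\<alpha>\<^sub>1 + \<tau>)"
    using assms by (intro divide_left_mono) auto
  then have t: "t > \<rho> / (\<alpha>\<^sub>1 + \<tau>)" "t > \<rho> / (\<alpha>\<^sub>1 + \<alpha>\<^sub>2)"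
    by (auto simp: t_def)
  define \<phi> where "\<phi> = restrict (\<lambda>z. ln 1 - t * ln (deriv_theta f \<tau> z)) (julia_set f)"
  have "(\<lambda>_. 1) \<in> locally_constant_weights \<S>"
    by (auto simp: locally_constant_weights_def constant_on_def)
  moreover have "ereal t > entire_order f / ereal (\<alpha>\<^sub>1 + \<tau>)"
    using \<alpha> t(1) by (simp add: \<rho> ereal_divide)
  ultimately have P: "\<phi> \<in> potentials_P f \<S> \<alpha>\<^sub>1 \<tau>"
    unfolding potentials_P_def \<phi>_def by fast
  have "ereal t > entire_order f / ereal (\<alpha>\<^sub>1 + \<alpha>\<^sub>2)"
    using \<alpha> t(2) by (simp add: \<rho> ereal_divide)
  then have "\<phi> \<in> potentials_T f \<S> \<alpha>\<^sub>1 \<alpha>\<^sub>2 \<tau>"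
    unfolding potentials_T_def \<phi>_def using weakly_hoelder_const
    by (intro CollectI exI[of _ "\<lambda>_. ln 1"] exI[of _ t]) auto
  with P show ?thesis
    by blast
qed

text \<open>A potential is only a function on the Julia set, so it might be tame through another
  exponent \<open>s\<close>. The weight is therefore made small against the derivative at one point
  \<open>Z k\<close> of each \<open>S k\<close>, which defeats all \<open>s\<close> and all bounds
  on \<open>h\<close> at once.\<close>

lemma potentials_Diff_nonempty:
  fixes Z :: "nat \<Rightarrow> complex" and S :: "nat \<Rightarrow> complex set"
  assumes \<rho>: "entire_order f = ereal \<rho>" and \<alpha>: "\<alpha>\<^sub>1 + \<tau> > 0"
    and disj: "\<And>A B z. A \<in> \<S> \<Longrightarrow> B \<in> \<S> \<Longrightarrow> z \<in> A \<Longrightarrow> z \<in> B \<Longrightarrow> A = B"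
    and S: "inj S" "\<And>k. S k \<in> \<S>" and Z: "\<And>k. Z k \<in> S k" "\<And>k. Z k \<in> julia_set f"
  shows "potentials_P f \<S> \<alpha>\<^sub>1 \<tau> - potentials_T f \<S> \<alpha>\<^sub>1 \<alpha>\<^sub>2 \<tau> \<noteq> {}"
proof -
  define L where "L k = ln (deriv_theta f \<tau> (Z k))" for k
  \<comment> \<open>For any real \<open>A\<close> and \<open>M\<close>, \<open>c k\<close> exceeds
    \<open>A * |L k| + M\<close> once \<open>k\<close> exceeds both.\<close>
  define c where "c k = real k * (1 + \<bar>L k\<bar>)" for k
  define t where "t = \<rho> / (\<alpha>\<^sub>1 + \<tau>) + 1"
  \<comment> \<open>The index is unique because the domains \<open>S k\<close> are distinct and
    distinct members of \<open>\<S>\<close> are disjoint.\<close>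
  define \<psi> where "\<psi> z = (if \<exists>k. z \<in> S k then exp (- c (THE k. z \<in> S k)) else 1)" for z
  have \<psi>: "\<psi> z = exp (- c k)" if "z \<in> S k" for z k
  proof -
    have "(THE k. z \<in> S k) = k"
      using that disj S by (intro the_equality) (metis injD)+
    then show ?thesis
      using that by (auto simp: \<psi>_def)
  qed
  have "\<psi> constant_on A" if A: "A \<in> \<S>" for A
  proof (cases "\<exists>k. A = S k")
    case True
    then show ?thesis
      using \<psi> by (auto simp: constant_on_def)
  next
    case False
    then have "\<psi> z = 1" if "z \<in> A" for z
      using that disj A S(2) by (force simp: \<psi>_def)
    then show ?thesis
      by (auto simp: constant_on_def)
  qed
  moreover have "\<psi> z > 0" "\<psi> z \<le> 1" for z
    by (auto simp: \<psi>_def c_def)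
  ultimately have \<psi>_weight: "\<psi> \<in> locally_constant_weights \<S>"
    unfolding locally_constant_weights_def by blast
  define \<phi> where "\<phi> = restrict (\<lambda>z. ln (\<psi> z) - t * ln (deriv_theta f \<tau> z)) (julia_set f)"
  have "ereal t > entire_order f / ereal (\<alpha>\<^sub>1 + \<tau>)"
    using \<alpha> by (simp add: \<rho> ereal_divide t_def)
  then have "\<phi> \<in> potentials_P f \<S> \<alpha>\<^sub>1 \<tau>"
    unfolding potentials_P_def \<phi>_def using \<psi>_weight by blast
  moreover have "\<phi> \<notin> potentials_T f \<S> \<alpha>\<^sub>1 \<alpha>\<^sub>2 \<tau>"
  proof
    assume "\<phi> \<in> potentials_T f \<S> \<alpha>\<^sub>1 \<alpha>\<^sub>2 \<tau>"
    then obtain h s M where eq: "\<phi> = restrict (\<lambda>z. h z - s * ln (deriv_theta f \<tau> z)) (julia_set f)"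
      and M: "\<And>z. z \<in> julia_set f \<Longrightarrow> \<bar>h z\<bar> \<le> M"
      unfolding potentials_T_def by blast
    obtain k where k: "real k > max \<bar>s - t\<bar> M"
      using reals_Archimedean2 by blast
    \<comment> \<open>Both representations are evaluated at \<open>Z k\<close>, where
      \<open>ln (\<psi> (Z k)) = - c k\<close>.\<close>
    have "- c k - t * L k = h (Z k) - s * L k"
      using fun_cong[OF eq, of "Z k"] \<psi>[OF Z(1)] Z(2) by (simp add: \<phi>_def L_def)
    then have "c k = (s - t) * L k - h (Z k)"
      by (simp add: algebra_simps)
    also have "\<dots> \<le> \<bar>s - t\<bar> * \<bar>L k\<bar> + M"
      using M[OF Z(2), of k] abs_ge_self[of "(s - t) * L k"] by (simp add: abs_mult)
    also have "\<dots> < real k * \<bar>L k\<bar> + real k"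
      using k by (intro add_le_less_mono mult_right_mono) auto
    finally show False
      by (simp add: c_def algebra_simps)
  qed
  ultimately show ?thesis
    by blast
qed

section \<open>The theorem for the exponential map\<close>

theorem theorem1:
  "\<exists>f\<in>class_F. 0 \<notin> julia_set f \<and>
     (\<exists>z0 D \<alpha> \<alpha>\<^sub>1 \<alpha>\<^sub>2 \<tau>. admissible_choice f z0 D \<alpha> \<alpha>\<^sub>1 \<alpha>\<^sub>2 \<tau>) \<and>
     (\<forall>z0 D \<alpha> \<alpha>\<^sub>1 \<alpha>\<^sub>2 \<tau>. admissible_choice f z0 D \<alpha> \<alpha>\<^sub>1 \<alpha>\<^sub>2 \<tau> \<longrightarrow>
        (let \<S> = fundamental_domains f D \<alpha> in
           potentials_P f \<S> \<alpha>\<^sub>1 \<tau> \<inter> potentials_T f \<S> \<alpha>\<^sub>1 \<alpha>\<^sub>2 \<tau> \<noteq> {} \<and>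
           potentials_P f \<S> \<alpha>\<^sub>1 \<tau> - potentials_T f \<S> \<alpha>\<^sub>1 \<alpha>\<^sub>2 \<tau> \<noteq> {}))"
proof (intro bexI[of _ exp_map] conjI allI impI)
  obtain z0 where z0: "disjoint_type_at exp_map z0" "base_domain exp_map z0 (ball 0 1)"
    and julia: "0 \<notin> julia_set exp_map"
    using base_domain_exp_map .
  obtain \<rho> where \<rho>: "entire_order exp_map = ereal \<rho>" "\<rho> \<ge> 0"
    using entire_order_exp_map .
  show "exp_map \<in> class_F"
    unfolding class_F_def
    using transcendental_entire_exp_map \<rho> rapid_derivative_growth_exp_map z0 by auto
  show "0 \<notin> julia_set exp_map"
    by (rule julia)
  \<comment> \<open>One admissible choice, so that the universal claim is not vacuous; 1/2 is a
    value of \<open>\<tau>\<close> strictly between 0 and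
    \<open>\<alpha>\<^sub>2 = 1\<close>.\<close>
  have "admissible_choice exp_map z0 (ball 0 1) (\<lambda>t. - 1 - of_real t) 0 1 (1/2)"
    unfolding admissible_choice_def
    using z0 cutting_arc_exp_map rapid_derivative_growth_exp_map by auto
  then show "\<exists>z0 D \<alpha> \<alpha>\<^sub>1 \<alpha>\<^sub>2 \<tau>. admissible_choice exp_map z0 D \<alpha> \<alpha>\<^sub>1 \<alpha>\<^sub>2 \<tau>"
    by blast
  fix z0 D \<alpha> \<alpha>\<^sub>1 \<alpha>\<^sub>2 \<tau>
  assume "admissible_choice exp_map z0 D \<alpha> \<alpha>\<^sub>1 \<alpha>\<^sub>2 \<tau>"
  then have adm: "disjoint_type_at exp_map z0" "base_domain exp_map z0 D" "cutting_arc exp_map D \<alpha>"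
    and params: "\<tau> < \<alpha>\<^sub>2" "\<alpha>\<^sub>1 + \<tau> > 0"
    unfolding admissible_choice_def by auto
  \<comment> \<open>0 is the only singular value, and \<open>D\<close> contains the singular
    values.\<close>
  have D: "connected D" "0 \<in> D"
    using adm(2) by (auto simp: base_domain_def sing_inv_exp_map)
  \<comment> \<open>Translates of the fixed point 2 by periods of \<open>exp\<close>, hence
    infinitely many preimages of 2.\<close>
  define Z :: "nat \<Rightarrow> complex" where "Z k = 2 + 2 * of_nat k * of_real pi * \<i>" for k
  have Z: "exp_map (Z k) = 2" for k
    unfolding Z_def by (rule exp_map_translate)
  have "inj Z"
    by (auto simp: Z_def inj_def)
  define \<S> where "\<S> = fundamental_domains exp_map D \<alpha>"
  have "\<forall>k. \<exists>S\<in>\<S>. Z k \<in> S"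
    using preimage_2_in_fundamental_domain[OF adm Z] by (auto simp: \<S>_def)
  then obtain S where S: "\<And>k. S k \<in> \<S>" "\<And>k. Z k \<in> S k"
    by metis
  \<comment> \<open>Injectivity of the map on each domain separates the points \<open>Z k\<close>,
    which share the image 2.\<close>
  have "inj S"
  proof (rule injI)
    fix j k
    assume "S j = S k"
    then have "Z j = Z k"
      using exp_map_inj_on_fundamental_domain[OF D adm(3)] S Z unfolding \<S>_def
      by (metis inj_onD)
    then show "j = k"
      using \<open>inj Z\<close> by (simp add: inj_eq)
  qed
  moreover have "potentials_P exp_map \<S> \<alpha>\<^sub>1 \<tau> \<inter> potentials_T exp_map \<S> \<alpha>\<^sub>1 \<alpha>\<^sub>2 \<tau> \<noteq> {}"
    using potentials_Int_nonempty[OF \<rho> params(2,1)] .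
  ultimately show "let \<S> = fundamental_domains exp_map D \<alpha> in
      potentials_P exp_map \<S> \<alpha>\<^sub>1 \<tau> \<inter> potentials_T exp_map \<S> \<alpha>\<^sub>1 \<alpha>\<^sub>2 \<tau> \<noteq> {} \<and>
      potentials_P exp_map \<S> \<alpha>\<^sub>1 \<tau> - potentials_T exp_map \<S> \<alpha>\<^sub>1 \<alpha>\<^sub>2 \<tau> \<noteq> {}"
    unfolding Let_def \<S>_def[symmetric]
    using potentials_Diff_nonempty[OF \<rho>(1) params(2) _ _ S preimage_2_in_julia_set[OF Z]]
      fundamental_domains_eqI[of _ exp_map D \<alpha>, folded \<S>_def] by auto
qed

end
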